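(* Let $\mu,\kappa,\lambda$ be infinite cardinals, let $X$ be a topological space, and let $\mathcal F$ be a family with $\emptyset\neq\mathcal F\subseteq\mathcal P(X)\setminus\{\emptyset\}$. Suppose that $\Phi(\mu,\kappa,\lambda)$ holds, that $X$ is $\mathcal F$-$\mu$-compact and $\lambda$-compact and, in case $\lambda$ is singular, suppose further that $X$ is $\operatorname{cf}\lambda$-compact. Then $X$ is $\mathcal F$-$\kappa$-compact.
   Context: Notation: for a set $S$ and a cardinal $\nu$, $[S]^{\nu}=\{Z\subseteq S : |Z|=\nu\}$ and $[S]^{<\nu}=\{Z\subseteq S : |Z|<\nu\}$; $\mathcal P(X)$ is the set of all subsets of $X$; $\operatorname{cf}\lambda$ is the cofinality of $\lambda$. Principle $\Phi(\mu,\kappa,\lambda)$ (for infinite cardinals, $\lambda$ not assumed regular): there exists a family $\{S_\xi : \xi<\lambda\}\subseteq[\kappa]^{\mu}$ (indexed by $\xi<\lambda$) such that $|\{\xi<\lambda : |A\cap S_\xi|=\mu\}|<\lambda$ for every $A\in[\kappa]^{<\kappa}$. Complete accumulation point: if $\mathcal Y$ is an infinite subset of $\mathcal P(X)$, a point $x\in X$ is a complete accumulation point of $\mathcal Y$ if $|\{Y\in\mathcal Y : Y\cap U\neq\emptyset\}|=|\mathcal Y|$ for every neighborhood $U$ of $x$ in $X$. A complete accumulation point of an infinite subset $Y$ of $X$ is a complete accumulation point of the family $\{\{y\}: y\in Y\}$. $X$ is $\mathcal F$-$\nu$-compact ($\nu$ an infinite cardinal) if every subfamily $\mathcal Y\subseteq\mathcal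 F$ of cardinality $\nu$ has a complete accumulation point in $X$. $X$ is $\nu$-compact if this holds for $\mathcal F$ the set of all singletons of $X$, i.e. every subset of $X$ of cardinality $\nu$ has a complete accumulation point. *)

theory Defs
  imports "HOL-Analysis.Abstract_Topology"
begin

unbundle cardinal_syntax

text \<open>
  Following HOL's library of cardinals, an infinite cardinal is a well-order \<open>r\<close> with
  \<open>Cinfinite r\<close>, i.e. \<open>Card_order r\<close> with infinite field. Its field, ordered by \<open>r\<close>, is the
  corresponding initial ordinal, so \<open>\<xi> < \<lambda>\<close> becomes \<open>\<xi> \<in> Field lam\<close> and subsets of \<open>\<kappa>\<close> become
  subsets of \<open>Field kap\<close>.
\<close>

subsection \<open>Cofinality\<close>

definition cf :: "'l rel \<Rightarrow> 'l rel" where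
  "cf r = |SOME K. K \<subseteq> Field r \<and> cofinal K r \<and>
                   (\<forall>L. L \<subseteq> Field r \<and> cofinal L r \<longrightarrow> |K| \<le>o |L| )|"

text \<open>
  The library's predicate \<open>cofinal\<close> asks for strict upper bounds, so only orders without a largest
  element have cofinal sets; infinite cardinals are of this kind, and there the choice in the
  definition of \<open>cf\<close> is meaningful:
\<close>

lemma cf_attained:
  assumes "Cinfinite r"
  obtains K where "K \<subseteq> Field r" "cofinal K r" "cf r = |K|"
    "\<And>L. L \<subseteq> Field r \<Longrightarrow> cofinal L r \<Longrightarrow> |K| \<le>o |L|"
proof -
  let ?C = "{K. K \<subseteq> Field r \<and> cofinal K r}"
  have "Field r \<in> ?C"
    using assms infinite_Card_order_limit[of r] by (auto simp: cofinal_def cinfinite_def)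
  then have "\<exists>s\<in>card_of ` ?C. \<forall>s'\<in>card_of ` ?C. s \<le>o s'"
    by (intro exists_minim_Card_order) (auto simp: card_of_Card_order)
  then have "\<exists>K. K \<subseteq> Field r \<and> cofinal K r \<and>
      (\<forall>L. L \<subseteq> Field r \<and> cofinal L r \<longrightarrow> |K| \<le>o |L| )"
    by auto
  from someI_ex[OF this] show thesis
    using that unfolding cf_def by blast
qed

lemma regularCard_iff_cf:
  assumes "Cinfinite r"
  shows "regularCard r \<longleftrightarrow> cf r =o r"
proof -
  obtain K where K: "K \<subseteq> Field r" "cofinal K r" "cf r = |K|"
    and min: "\<And>L. L \<subseteq> Field r \<Longrightarrow> cofinal L r \<Longrightarrow> |K| \<le>o |L|"
    using cf_attained[OF assms] by blast
  show ?thesis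
  proof
    assume "regularCard r"
    then show "cf r =o r"
      using K by (simp add: regularCard_def)
  next
    assume "cf r =o r"
    then have Kr: "|K| =o r"
      using K by simp
    have Fr: "|Field r| =o r"
      using assms card_of_Field_ordIso by blast
    show "regularCard r"
      unfolding regularCard_def
    proof (intro allI impI)
      fix L assume L: "L \<subseteq> Field r \<and> cofinal L r"
      have "|L| \<le>o r"
        using L Fr card_of_mono1 ordLeq_ordIso_trans by blast
      moreover have "r \<le>o |L|"
        using min[of L] L Kr ordIso_ordLeq_trans ordIso_symmetric by blast
      ultimately show "|L| =o r"
        by (simp add: ordIso_iff_ordLeq)
    qed
  qed
qed

subsection \<open>The principle \<open>\<Phi>(\<mu>, \<kappa>, \<lambda>)\<close>\<close>

definition Phi :: "'m rel \<Rightarrow> 'k rel \<Rightarrow> 'l rel \<Rightarrow> bool" where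
  "Phi mu kap lam \<longleftrightarrow>
     (\<exists>S :: 'l \<Rightarrow> 'k set.
        (\<forall>\<xi>\<in>Field lam. S \<xi> \<subseteq> Field kap \<and> |S \<xi>| =o mu) \<and>
        (\<forall>A. A \<subseteq> Field kap \<and> |A| <o kap \<longrightarrow>
             |{\<xi>\<in>Field lam. |A \<inter> S \<xi>| =o mu}| <o lam))"

subsection \<open>Complete accumulation points and compactness\<close>

definition neighbourhood_of :: "'a topology \<Rightarrow> 'a \<Rightarrow> 'a set \<Rightarrow> bool" where
  "neighbourhood_of X x U \<longleftrightarrow> U \<subseteq> topspace X \<and> (\<exists>V. openin X V \<and> x \<in> V \<and> V \<subseteq> U)"

text \<open>Only intended for infinite \<open>\<Y>\<close> consisting of subsets of \<open>topspace X\<close>.\<close>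

definition complete_acc_point :: "'a topology \<Rightarrow> 'a set set \<Rightarrow> 'a \<Rightarrow> bool" where
  "complete_acc_point X \<Y> x \<longleftrightarrow>
     x \<in> topspace X \<and> (\<forall>U. neighbourhood_of X x U \<longrightarrow> |{Y\<in>\<Y>. Y \<inter> U \<noteq> {}}| =o |\<Y>| )"

definition family_compact :: "'a topology \<Rightarrow> 'a set set \<Rightarrow> 'n rel \<Rightarrow> bool" where
  "family_compact X \<F> nu \<longleftrightarrow>
     (\<forall>\<Y>. \<Y> \<subseteq> \<F> \<and> |\<Y>| =o nu \<longrightarrow> (\<exists>x. complete_acc_point X \<Y> x))"

definition card_compact :: "'a topology \<Rightarrow> 'n rel \<Rightarrow> bool" where
  "card_compact X nu \<longleftrightarrow> family_compact X ((\<lambda>x. {x}) ` topspace X) nu"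

lemma complete_acc_point_singletons:
  "complete_acc_point X ((\<lambda>y. {y}) ` Y) x \<longleftrightarrow>
     x \<in> topspace X \<and> (\<forall>U. neighbourhood_of X x U \<longrightarrow> |Y \<inter> U| =o |Y| )"
proof -
  have iso: "|(\<lambda>y. {y}) ` Z| =o |Z|" for Z :: "'a set"
    by (rule ordIso_symmetric, rule card_of_ordIsoI[of "\<lambda>y. {y}"]) (auto simp: bij_betw_def)
  have "{W \<in> (\<lambda>y. {y}) ` Y. W \<inter> U \<noteq> {}} = (\<lambda>y. {y}) ` (Y \<inter> U)" for U
    by auto
  moreover have "|(\<lambda>y. {y}) ` (Y \<inter> U)| =o |(\<lambda>y. {y}) ` Y| \<longleftrightarrow> |Y \<inter> U| =o |Y|" for U
    using iso[of "Y \<inter> U"] iso[of Y] by (meson ordIso_symmetric ordIso_transitive)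
  ultimately show ?thesis
    by (simp add: complete_acc_point_def)
qed

end

theory Submission
  imports Defs
begin

text \<open>
  Let \<open>\<Y>\<close> be a subfamily of \<open>\<F>\<close> of size \<open>\<kappa>\<close>, enumerated injectively as \<open>g \<alpha>\<close> for \<open>\<alpha> < \<kappa>\<close>, and let
  \<open>S \<xi>\<close>, \<open>\<xi> < \<lambda>\<close>, witness \<open>\<Phi>(\<mu>, \<kappa>, \<lambda>)\<close>. By \<open>\<F>\<close>-\<open>\<mu>\<close>-compactness each subfamily
  \<open>{g \<alpha> | \<alpha> \<in> S \<xi>}\<close> has a complete accumulation point \<open>y \<xi>\<close>. Any point \<open>x\<close> around which the
  sequence \<open>y\<close> accumulates \<open>\<lambda>\<close> many times is a complete accumulation point of \<open>\<Y>\<close>: if a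
  neighbourhood \<open>U\<close> of \<open>x\<close> met fewer than \<open>\<kappa>\<close> members of \<open>\<Y>\<close>, then the set \<open>A\<close> of their indices would
  satisfy \<open>|A \<inter> S \<xi>| = \<mu>\<close> for fewer than \<open>\<lambda>\<close> indices \<open>\<xi>\<close>; but this equality holds whenever \<open>y \<xi>\<close>
  lies in the interior of \<open>U\<close>, hence for \<open>\<lambda>\<close> many \<open>\<xi>\<close>.

  It remains to find such an \<open>x\<close> for an arbitrary \<open>\<lambda>\<close>-sequence \<open>y\<close> of points, and the difficulty is
  that \<open>y\<close> may repeat points (\<open>sequence_accumulates\<close>). If \<open>y\<close> has \<open>\<lambda>\<close> distinct values, a complete
  accumulation point of the set of values will do, and if some value is taken \<open>\<lambda>\<close> times, that value
  will do. In the remaining case \<open>\<lambda>\<close> is the size of a union of fewer than \<open>\<lambda>\<close> fibres, each of size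
  below \<open>\<lambda>\<close>. Then \<open>\<lambda>\<close> is singular and the sizes of the fibres are unbounded in \<open>\<lambda>\<close>. This allows
  the choice of a set \<open>W\<close> of \<open>cf \<lambda>\<close> values such that the fibres over any \<open>cf \<lambda>\<close> of them still have
  unbounded sizes (\<open>unbounded_subfamily\<close>), and a complete accumulation point of \<open>W\<close> will do.
\<close>

section \<open>Cofinal sets in infinite cardinals\<close>

lemma card_of_finite_ordLess_infinite: "finite A \<Longrightarrow> infinite B \<Longrightarrow> |A| <o |B|"
  by (rule finite_ordLess_infinite) (simp_all add: card_of_well_order_on Field_card_of)

lemma finite_not_cofinal:
  assumes "Cinfinite r" and "finite K" and "K \<subseteq> Field r"
  shows "\<not> cofinal K r"
proof -
  have wo: "wo_rel r"
    using assms(1) by (simp add: wo_rel_def card_order_on_well_order_on)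
  have ne: "Field r \<noteq> {}"
    using assms(1) by (auto simp: cinfinite_def)
  from \<open>finite K\<close> \<open>K \<subseteq> Field r\<close> have "\<exists>b\<in>Field r. \<forall>a\<in>K. (a, b) \<in> r"
  proof (induction rule: finite_induct)
    case empty
    then show ?case using ne by auto
  next
    case (insert x L)
    then obtain b where b: "b \<in> Field r" "\<forall>a\<in>L. (a, b) \<in> r" by auto
    have x: "x \<in> Field r" using insert by auto
    consider "(x, b) \<in> r" | "(b, x) \<in> r"
      using wo_rel.TOTALS[OF wo] b x by blast
    then show ?case
    proof cases
      case 1
      then show ?thesis using b by auto
    next
      case 2
      then have "\<forall>a\<in>insert x L. (a, x) \<in> r"
        using b x wo_rel.TOTALS[OF wo] transD[OF wo_rel.TRANS[OF wo]] by blast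
      then show ?thesis using x by blast
    qed
  qed
  then obtain b where b: "b \<in> Field r" "\<forall>a\<in>K. (a, b) \<in> r" by auto
  show ?thesis
  proof
    assume "cofinal K r"
    then obtain a where "a \<in> K" "b \<noteq> a" "(b, a) \<in> r"
      using b by (auto simp: cofinal_def)
    then show False
      using b wo_rel.ANTISYM[OF wo] by (auto simp: antisym_def)
  qed
qed

lemma not_cofinal_bound:
  assumes "Cinfinite r" and "K \<subseteq> Field r" and "\<not> cofinal K r"
  shows "\<exists>b\<in>Field r. \<forall>a\<in>K. (a, b) \<in> r"
proof -
  have wo: "wo_rel r"
    using assms(1) by (simp add: wo_rel_def card_order_on_well_order_on)
  from assms(3) obtain b where "b \<in> Field r" "\<forall>a\<in>K. b = a \<or> (b, a) \<notin> r"
    by (auto simp: cofinal_def)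
  then show ?thesis
    using wo_rel.TOTALS[OF wo] assms(2) by (metis subsetD)
qed

text \<open>
  A subset of \<open>K\<close> of full size need not be cofinal if \<open>K\<close> is merely a cofinal set of least size,
  because an initial part of \<open>K\<close> may be as large as \<open>K\<close>. The remedy is to reorder \<open>K\<close> as an initial
  ordinal and to replace \<open>k\<close> by a bound \<open>s k\<close> of its predecessors in the new order: these are
  fewer than \<open>cf r\<close> elements, hence bounded. A subset of full size is cofinal in the new order, and so
  its bounds dominate all of \<open>K\<close>.
\<close>

lemma hereditarily_cofinal_map:
  assumes r: "Cinfinite r"
  obtains K :: "'l set" and s :: "'l \<Rightarrow> 'l" where
    "cf r = |K|"
    "\<And>L. L \<subseteq> Field r \<Longrightarrow> cofinal L r \<Longrightarrow> |K| \<le>o |L|"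
    "\<And>k. k \<in> K \<Longrightarrow> s k \<in> Field r"
    "\<And>L. L \<subseteq> K \<Longrightarrow> |L| =o |K| \<Longrightarrow> cofinal (s ` L) r"
proof -
  have wo: "wo_rel r"
    using r by (simp add: wo_rel_def card_order_on_well_order_on)
  obtain K where K: "K \<subseteq> Field r" "cofinal K r" "cf r = |K|"
    and min: "\<And>L. L \<subseteq> Field r \<Longrightarrow> cofinal L r \<Longrightarrow> |K| \<le>o |L|"
    using cf_attained[OF r] by blast
  have infK: "infinite K"
    using finite_not_cofinal[OF r] K by blast
  have woK: "wo_rel |K|"
    by (simp add: wo_rel_def card_of_Well_order)
  have "\<exists>b\<in>Field r. \<forall>a\<in>underS |K| k. (a, b) \<in> r" if "k \<in> K" for k
  proof (rule not_cofinal_bound[OF r])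
    have sub: "underS |K| k \<subseteq> K"
      using underS_Field[of _ "|K|" k] by (auto simp: Field_card_of)
    then show "underS |K| k \<subseteq> Field r"
      using K by blast
    have "|underS |K| k| <o |K|"
      using that by (intro card_of_underS) (auto simp: card_of_card_order_on Field_card_of)
    then show "\<not> cofinal (underS |K| k) r"
      using min[of "underS |K| k"] sub K(1) not_ordLess_ordLeq by blast
  qed
  then obtain s where s: "\<And>k. k \<in> K \<Longrightarrow> s k \<in> Field r"
    and bd: "\<And>k a. k \<in> K \<Longrightarrow> a \<in> underS |K| k \<Longrightarrow> (a, s k) \<in> r"
    by metis
  have "cofinal (s ` L) r" if L: "L \<subseteq> K" "|L| =o |K|" for L
    unfolding cofinal_def
  proof
    fix a assume "a \<in> Field r"
    then obtain k where k: "k \<in> K" "a \<noteq> k" "(a, k) \<in> r"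
      using K by (auto simp: cofinal_def)
    have "\<exists>l\<in>L. k \<in> underS |K| l"
    proof (rule ccontr)
      assume "\<not> ?thesis"
      then have "l = k \<or> (k, l) \<notin> |K|" if "l \<in> L" for l
        using that by (auto simp: underS_def)
      moreover have "(l, k) \<in> |K| \<or> (k, l) \<in> |K|" if "l \<in> L" for l
        using that L(1) k(1) wo_rel.TOTALS[OF woK] by (auto simp: Field_card_of)
      moreover have "(k, k) \<in> |K|"
        using k(1) wo_rel.TOTALS[OF woK] by (auto simp: Field_card_of)
      ultimately have "L \<subseteq> under |K| k"
        unfolding under_def by blast
      also have "under |K| k = {k} \<union> underS |K| k"
        using k(1) wo_rel.TOTALS[OF woK] by (auto simp: Field_card_of underS_def under_def)
      finally have "|L| \<le>o |{k} \<union> underS |K| k|"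
        by (rule card_of_mono1)
      moreover have "|{k} \<union> underS |K| k| <o |K|"
      proof (rule card_of_Un_ordLess_infinite[OF infK])
        show "|{k}| <o |K|"
          using infK by (intro card_of_finite_ordLess_infinite) simp_all
        show "|underS |K| k| <o |K|"
          using k by (intro card_of_underS) (auto simp: card_of_card_order_on Field_card_of)
      qed
      ultimately have "|L| <o |K|"
        by (rule ordLeq_ordLess_trans)
      then show False
        using L(2) not_ordLess_ordIso by blast
    qed
    then obtain l where l: "l \<in> L" "k \<in> underS |K| l" by blast
    then have "(k, s l) \<in> r" using bd L by blast
    then have "(a, s l) \<in> r" "a \<noteq> s l"
      using k transD[OF wo_rel.TRANS[OF wo]] antisymD[OF wo_rel.ANTISYM[OF wo]] by blast+
    then show "\<exists>b\<in>s ` L. a \<noteq> b \<and> (a, b) \<in> r" using l by blast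
  qed
  then show thesis
    using that[of K s] K(3) min s by blast
qed

section \<open>Families of small sets with unbounded sizes\<close>

lemma ordLess_as_underS:
  assumes "Card_order r" and "|B| <o r"
  obtains c where "c \<in> Field r" "|B| =o |underS r c|"
proof -
  have w: "Well_order r" using assms(1) by (simp add: card_order_on_well_order_on)
  then obtain c where c: "c \<in> Field r" "|B| =o Restr r (underS r c)"
    using ordLess_iff_ordIso_Restr[OF w card_of_Well_order, of B] assms(2) by blast
  have "|B| =o |Field (Restr r (underS r c))|"
    using card_of_cong[OF c(2)] by (simp add: Field_card_of)
  moreover have "Field (Restr r (underS r c)) = underS r c"
    using w by (simp add: Field_Restr_ofilter wo_rel.underS_ofilter wo_rel_def)
  ultimately show thesis using c(1) by (intro that) simp_all
qed

text \<open>
  Strictness matters: with a weak inequality the conclusion of \<open>large_union\<close> would fail for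
  successor cardinals.
\<close>

definition unbounded_sizes :: "'l rel \<Rightarrow> 'a set \<Rightarrow> ('a \<Rightarrow> 'b set) \<Rightarrow> bool" where
  "unbounded_sizes r Z F \<longleftrightarrow> (\<forall>c\<in>Field r. \<exists>z\<in>Z. |underS r c| <o |F z| )"

lemma large_union:
  assumes r: "Card_order r" and un: "unbounded_sizes r Z F"
  shows "r \<le>o |\<Union>z\<in>Z. F z|"
proof (rule ccontr)
  assume "\<not> ?thesis"
  then have "|\<Union>z\<in>Z. F z| <o r"
    using r by (simp add: card_order_on_well_order_on card_of_Well_order not_ordLeq_iff_ordLess)
  then obtain c where c: "c \<in> Field r" "|\<Union>z\<in>Z. F z| =o |underS r c|"
    using ordLess_as_underS[OF r] by blast
  then obtain z where z: "z \<in> Z" "|underS r c| <o |F z|"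
    using un by (auto simp: unbounded_sizes_def)
  then have "|\<Union>z\<in>Z. F z| <o |F z|"
    using c ordIso_ordLess_trans by blast
  moreover have "|F z| \<le>o |\<Union>z\<in>Z. F z|"
    using z by (intro card_of_mono1) blast
  ultimately show False
    using not_ordLess_ordLeq by blast
qed

text \<open>
  If all sizes were at most some \<open>\<nu> < r\<close>, the union would be finite or of size at most
  \<open>|Z| + \<nu>\<close>, hence below \<open>r\<close>.
\<close>

lemma few_sets_with_large_union:
  fixes r :: "'l rel"
  assumes r: "Cinfinite r" and Z: "|Z| <o r" and U: "r \<le>o |\<Union>z\<in>Z. F z|"
  shows "unbounded_sizes r Z F"
  unfolding unbounded_sizes_def
proof (rule ballI, rule ccontr)
  fix c assume c: "c \<in> Field r" and "\<not> (\<exists>z\<in>Z. |underS r c| <o |F z| )"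
  then have le: "\<forall>z\<in>Z. |F z| \<le>o |underS r c|"
    by (simp add: card_of_Well_order not_ordLess_iff_ordLeq)
  have F: "|Field r| =o r" and inf: "infinite (Field r)"
    using r card_of_Field_ordIso by (auto simp: cinfinite_def)
  have c': "|underS r c| <o r"
    using r c by (intro card_of_underS) auto
  define B where "B = Z <+> underS r c"
  have B: "|B| <o r"
    unfolding B_def using inf _ Z c' by (rule card_of_Plus_ordLess_infinite_Field) (use r in blast)
  have "|\<Union>z\<in>Z. F z| <o r"
  proof (cases "finite B")
    case True
    then have "finite (F z)" if "z \<in> Z" for z
      using that le card_of_ordLeq_finite by (auto simp: B_def)
    then have "finite (\<Union>z\<in>Z. F z)"
      using True by (auto simp: B_def)
    then show ?thesis
      by (rule ordLess_ordIso_trans[OF card_of_finite_ordLess_infinite[OF _ inf] F])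
  next
    case False
    have "|underS r c| \<le>o |B|" "|Z| \<le>o |B|"
      unfolding B_def by (rule card_of_Plus2, rule card_of_Plus1)
    then have "|\<Union>z\<in>Z. F z| \<le>o |B|"
      using le by (intro card_of_UNION_ordLeq_infinite[OF False]) (auto intro: ordLeq_transitive)
    then show ?thesis
      using B by (rule ordLeq_ordLess_trans)
  qed
  then show False
    using U not_ordLess_ordLeq by blast
qed

text \<open>
  Sending \<open>z\<close> to an ordinal with \<open>|F z|\<close> predecessors maps \<open>W\<close> onto a cofinal set. Hence a family
  with unbounded sizes has at least \<open>cf r\<close> members.
\<close>

lemma cf_le_unbounded:
  assumes r: "Cinfinite r" and small: "\<And>z. z \<in> W \<Longrightarrow> |F z| <o r"
    and un: "unbounded_sizes r W F"
  obtains L where "L \<subseteq> Field r" "cofinal L r" "|L| \<le>o |W|"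
proof -
  have wo: "wo_rel r"
    using r by (simp add: wo_rel_def card_order_on_well_order_on)
  have "\<exists>c\<in>Field r. |F z| =o |underS r c|" if "z \<in> W" for z
    using ordLess_as_underS[of r "F z"] small[OF that] r by blast
  then obtain g where g: "\<And>z. z \<in> W \<Longrightarrow> g z \<in> Field r"
    "\<And>z. z \<in> W \<Longrightarrow> |F z| =o |underS r (g z)|"
    by metis
  have "cofinal (g ` W) r"
    unfolding cofinal_def
  proof
    fix c assume c: "c \<in> Field r"
    then obtain z where z: "z \<in> W" "|underS r c| <o |F z|"
      using un by (auto simp: unbounded_sizes_def)
    then have lt: "|underS r c| <o |underS r (g z)|"
      using g ordLess_ordIso_trans by blast
    have "(g z, c) \<notin> r"
    proof
      assume "(g z, c) \<in> r"
      then have "underS r (g z) \<subseteq> underS r c"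
        by (rule underS_incr[OF wo_rel.TRANS[OF wo] wo_rel.ANTISYM[OF wo]])
      then show False
        using lt card_of_mono1 not_ordLess_ordLeq by blast
    qed
    then have "(c, g z) \<in> r" "c \<noteq> g z"
      using wo_rel.TOTALS[OF wo] c g(1)[OF z(1)] by blast+
    then show "\<exists>b\<in>g ` W. c \<noteq> b \<and> (c, b) \<in> r" using z by blast
  qed
  then show thesis
    using that[of "g ` W"] g card_of_image by blast
qed

text \<open>
  Along a hereditarily cofinal map into \<open>r\<close>, choose members of larger and larger size. Distinct
  indices may lead to the same member; that \<open>cf r\<close> members remain is forced by \<open>cf_le_unbounded\<close>.
\<close>

lemma unbounded_subfamily:
  fixes r :: "'l rel" and F :: "'a \<Rightarrow> 'b set"
  assumes r: "Cinfinite r" and small: "\<And>z. z \<in> Z \<Longrightarrow> |F z| <o r"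
    and un: "unbounded_sizes r Z F"
  obtains W where "W \<subseteq> Z" "|W| =o cf r"
    "\<And>V. V \<subseteq> W \<Longrightarrow> |V| =o |W| \<Longrightarrow> unbounded_sizes r V F"
proof -
  have wo: "wo_rel r"
    using r by (simp add: wo_rel_def card_order_on_well_order_on)
  obtain K :: "'l set" and s where cf: "cf r = |K|"
    and min: "\<And>L. L \<subseteq> Field r \<Longrightarrow> cofinal L r \<Longrightarrow> |K| \<le>o |L|"
    and s: "\<And>k. k \<in> K \<Longrightarrow> s k \<in> Field r"
    and her: "\<And>L. L \<subseteq> K \<Longrightarrow> |L| =o |K| \<Longrightarrow> cofinal (s ` L) r"
    using hereditarily_cofinal_map[OF r] by blast
  have "\<exists>z\<in>Z. |underS r (s k)| <o |F z|" if "k \<in> K" for k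
    using un s[OF that] by (auto simp: unbounded_sizes_def)
  then obtain z where z: "\<And>k. k \<in> K \<Longrightarrow> z k \<in> Z"
    "\<And>k. k \<in> K \<Longrightarrow> |underS r (s k)| <o |F (z k)|"
    by metis
  have big: "unbounded_sizes r (z ` L) F" if L: "L \<subseteq> K" "|L| =o |K|" for L
    unfolding unbounded_sizes_def
  proof
    fix c assume "c \<in> Field r"
    then obtain k where k: "k \<in> L" "(c, s k) \<in> r"
      using her[OF L] by (auto simp: cofinal_def)
    then have "underS r c \<subseteq> underS r (s k)"
      by (intro underS_incr[OF wo_rel.TRANS[OF wo] wo_rel.ANTISYM[OF wo]])
    then have "|underS r c| \<le>o |underS r (s k)|"
      by (rule card_of_mono1)
    then have "|underS r c| <o |F (z k)|"
      using z(2)[of k] k L ordLeq_ordLess_trans by blast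
    then show "\<exists>w\<in>z ` L. |underS r c| <o |F w|" using k by blast
  qed
  have sm: "\<And>w. w \<in> z ` K \<Longrightarrow> |F w| <o r"
    using z small by blast
  obtain L where L: "L \<subseteq> Field r" "cofinal L r" "|L| \<le>o |z ` K|"
    using cf_le_unbounded[OF r sm big[OF subset_refl]] by (auto simp: card_of_refl)
  have "|K| \<le>o |z ` K|"
    using min[OF L(1,2)] L(3) ordLeq_transitive by blast
  then have iso: "|z ` K| =o |K|"
    by (simp add: ordIso_iff_ordLeq card_of_image)
  show thesis
  proof (rule that)
    show "z ` K \<subseteq> Z" using z by blast
    show "|z ` K| =o cf r" using iso cf by simp
    fix V assume V: "V \<subseteq> z ` K" "|V| =o |z ` K|"
    \<comment> \<open>One index for each element of \<open>V\<close> already gives \<open>|K|\<close> many indices.\<close>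
    then obtain L where L: "L \<subseteq> K" "inj_on z L" "V = z ` L"
      by (auto simp: subset_image_inj)
    then have "|L| =o |V|"
      using card_of_ordIsoI[of z L V] by (simp add: bij_betw_def)
    then have "|L| =o |K|"
      using ordIso_transitive[OF _ ordIso_transitive[OF V(2) iso]] by blast
    then show "unbounded_sizes r V F"
      using big L by blast
  qed
qed

section \<open>Accumulation of transfinite sequences\<close>

lemma card_compactE:
  assumes "card_compact X nu" and "Y \<subseteq> topspace X" and "|Y| =o nu"
  obtains x where "x \<in> topspace X"
    "\<And>U. neighbourhood_of X x U \<Longrightarrow> |Y \<inter> U| =o |Y|"
proof -
  have "|(\<lambda>y. {y}) ` Y| =o |Y|"
    by (rule ordIso_symmetric, rule card_of_ordIsoI[of "\<lambda>y. {y}"]) (auto simp: bij_betw_def)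
  then have "|(\<lambda>y. {y}) ` Y| =o nu"
    using assms(3) ordIso_transitive by blast
  moreover have "(\<lambda>y. {y}) ` Y \<subseteq> (\<lambda>x. {x}) ` topspace X"
    using assms(2) by blast
  ultimately obtain x where "complete_acc_point X ((\<lambda>y. {y}) ` Y) x"
    using assms(1) unfolding card_compact_def family_compact_def by blast
  then show thesis
    using that by (auto simp: complete_acc_point_singletons)
qed

lemma neighbourhood_of_mem: "neighbourhood_of X x U \<Longrightarrow> x \<in> U"
  by (auto simp: neighbourhood_of_def)

text \<open>
  Either there are \<open>\<lambda>\<close> distinct values, or some value is taken \<open>\<lambda>\<close> times, or \<open>\<lambda>\<close> is split into fewer
  than \<open>\<lambda>\<close> fibres of size below \<open>\<lambda>\<close>. The split forces \<open>\<lambda>\<close> to be singular, and then a neighbourhood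
  that catches \<open>cf \<lambda>\<close> well-chosen values catches \<open>\<lambda>\<close> indices, as the fibres over them are unbounded
  in size.
\<close>

lemma sequence_accumulates:
  fixes lam :: "'l rel" and X :: "'a topology" and y :: "'l \<Rightarrow> 'a"
  assumes lam: "Cinfinite lam" and comp: "card_compact X lam"
    and cf_comp: "\<not> regularCard lam \<Longrightarrow> card_compact X (cf lam)"
    and y: "y ` Field lam \<subseteq> topspace X"
  obtains x where "x \<in> topspace X"
    "\<And>U. neighbourhood_of X x U \<Longrightarrow> |{\<xi>\<in>Field lam. y \<xi> \<in> U}| =o lam"
proof -
  define Z where "Z = y ` Field lam"
  define F where "F z = {\<xi>\<in>Field lam. y \<xi> = z}" for z
  have card: "Card_order lam" using lam by blast
  have Fl: "|Field lam| =o lam" using card by (rule card_of_Field_ordIso)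
  have le: "|A| \<le>o lam" if "A \<subseteq> Field lam" for A
    using card_of_mono1[OF that] Fl ordLeq_ordIso_trans by blast
  have hit: "|{\<xi>\<in>Field lam. y \<xi> \<in> U}| =o lam" if "lam \<le>o |{\<xi>\<in>Field lam. y \<xi> \<in> U}|" for U
    using that le[of "{\<xi>\<in>Field lam. y \<xi> \<in> U}"] by (simp add: ordIso_iff_ordLeq)
  have "|Z| \<le>o lam"
    unfolding Z_def using card_of_image Fl ordLeq_ordIso_trans by blast
  then have Z: "|Z| =o lam \<or> |Z| <o lam"
    by (auto simp: ordLeq_iff_ordLess_or_ordIso)
  have dich: "lam \<le>o |F z| \<or> |F z| <o lam" for z
    using ordLess_or_ordLeq[OF card_of_Well_order, of lam "F z"] card
    by (auto simp: card_order_on_well_order_on)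
  consider "|Z| =o lam" | z where "z \<in> Z" "lam \<le>o |F z|"
    | "|Z| <o lam" "\<And>z. z \<in> Z \<Longrightarrow> |F z| <o lam"
    using Z dich by blast
  then show thesis
  proof cases
    case 1
    obtain x where x: "x \<in> topspace X" "\<And>U. neighbourhood_of X x U \<Longrightarrow> |Z \<inter> U| =o |Z|"
      using card_compactE[OF comp _ 1] y Z_def by blast
    show thesis
    proof (rule that[OF x(1)], rule hit)
      fix U assume "neighbourhood_of X x U"
      then have "lam =o |Z \<inter> U|"
        using ordIso_symmetric[OF ordIso_transitive[OF x(2) 1]] by blast
      moreover have "Z \<inter> U = y ` {\<xi>\<in>Field lam. y \<xi> \<in> U}"
        by (auto simp: Z_def)
      ultimately show "lam \<le>o |{\<xi>\<in>Field lam. y \<xi> \<in> U}|"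
        using ordIso_ordLeq_trans[OF _ card_of_image] by auto
    qed
  next
    case 2
    show thesis
    proof (rule that[of z], rule_tac [2] hit)
      show "z \<in> topspace X" using 2 y Z_def by blast
      fix U assume "neighbourhood_of X z U"
      then have "F z \<subseteq> {\<xi>\<in>Field lam. y \<xi> \<in> U}"
        using neighbourhood_of_mem[of X z U] by (auto simp: F_def)
      then show "lam \<le>o |{\<xi>\<in>Field lam. y \<xi> \<in> U}|"
        by (intro ordLeq_transitive[OF 2(2)] card_of_mono1)
    qed
  next
    case 3
    have "(\<Union>z\<in>Z. F z) = Field lam" by (auto simp: Z_def F_def)
    then have U: "lam \<le>o |\<Union>z\<in>Z. F z|"
      using Fl by (simp add: ordIso_iff_ordLeq)
    have "\<not> regularCard lam"
      using card_of_UNION_ordLess_infinite_Field_regularCard[of lam Z F] 3 lam U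
        not_ordLess_ordLeq by blast
    note comp' = cf_comp[OF this]
    obtain W where W: "W \<subseteq> Z" "|W| =o cf lam"
      "\<And>V. V \<subseteq> W \<Longrightarrow> |V| =o |W| \<Longrightarrow> unbounded_sizes lam V F"
      using unbounded_subfamily[OF lam 3(2) few_sets_with_large_union[OF lam 3(1) U]] by blast
    obtain x where x: "x \<in> topspace X" "\<And>U. neighbourhood_of X x U \<Longrightarrow> |W \<inter> U| =o |W|"
      using card_compactE[OF comp' _ W(2)] W(1) y Z_def by blast
    show thesis
    proof (rule that[OF x(1)], rule hit)
      fix U assume "neighbourhood_of X x U"
      then have "unbounded_sizes lam (W \<inter> U) F"
        using x(2) W(3) by blast
      then have "lam \<le>o |\<Union>z\<in>W \<inter> U. F z|"
        by (rule large_union[OF card])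
      moreover have "(\<Union>z\<in>W \<inter> U. F z) \<subseteq> {\<xi>\<in>Field lam. y \<xi> \<in> U}"
        by (auto simp: F_def)
      ultimately show "lam \<le>o |{\<xi>\<in>Field lam. y \<xi> \<in> U}|"
        using ordLeq_transitive[OF _ card_of_mono1] by blast
    qed
  qed
qed

section \<open>Transfer of compactness from \<open>\<mu>\<close> to \<open>\<kappa>\<close>\<close>

theorem theorem2p1:
  fixes mu :: "'m rel" and kap :: "'k rel" and lam :: "'l rel"
    and X :: "'a topology" and \<F> :: "'a set set"
  assumes "Cinfinite mu" and "Cinfinite kap" and "Cinfinite lam"
    and "\<F> \<noteq> {}" and "\<F> \<subseteq> Pow (topspace X) - {{}}"
    and "Phi mu kap lam"
    and "family_compact X \<F> mu"
    and "card_compact X lam"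
    and "\<not> regularCard lam \<Longrightarrow> card_compact X (cf lam)"
  shows "family_compact X \<F> kap"
  unfolding family_compact_def
proof (intro allI impI, elim conjE)
  fix \<Y> assume Y: "\<Y> \<subseteq> \<F>" "|\<Y>| =o kap"
  have "|Field kap| =o |\<Y>|"
    using assms(2) by (intro ordIso_transitive[OF card_of_Field_ordIso ordIso_symmetric[OF Y(2)]]) blast
  then obtain g where g: "bij_betw g (Field kap) \<Y>"
    using card_of_ordIso by blast
  have inj: "inj_on g A" if "A \<subseteq> Field kap" for A
    using g that by (auto simp: bij_betw_def intro: inj_on_subset)
  have iso: "|g ` A| =o |A|" if "A \<subseteq> Field kap" for A
    using card_of_ordIsoI[of g A "g ` A"] inj[OF that] by (simp add: bij_betw_def ordIso_symmetric)
  obtain S :: "'l \<Rightarrow> 'k set" where S: "\<And>\<xi>. \<xi> \<in> Field lam \<Longrightarrow> S \<xi> \<subseteq> Field kap"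
    "\<And>\<xi>. \<xi> \<in> Field lam \<Longrightarrow> |S \<xi>| =o mu"
    and few: "\<And>A. A \<subseteq> Field kap \<Longrightarrow> |A| <o kap \<Longrightarrow>
                 |{\<xi>\<in>Field lam. |A \<inter> S \<xi>| =o mu}| <o lam"
    using assms(6) unfolding Phi_def by blast
  have "\<exists>x. complete_acc_point X (g ` S \<xi>) x" if "\<xi> \<in> Field lam" for \<xi>
  proof -
    have "g ` S \<xi> \<subseteq> \<F>"
      using g S(1)[OF that] Y(1) by (auto simp: bij_betw_def)
    moreover have "|g ` S \<xi>| =o mu"
      using ordIso_transitive[OF iso[OF S(1)[OF that]] S(2)[OF that]] .
    ultimately show ?thesis
      using assms(7) unfolding family_compact_def by blast
  qed
  then obtain y where y: "\<And>\<xi>. \<xi> \<in> Field lam \<Longrightarrow> complete_acc_point X (g ` S \<xi>) (y \<xi>)"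
    by metis
  have "y ` Field lam \<subseteq> topspace X"
    using y by (auto simp: complete_acc_point_def)
  then obtain x where x: "x \<in> topspace X"
    and acc: "\<And>U. neighbourhood_of X x U \<Longrightarrow> |{\<xi>\<in>Field lam. y \<xi> \<in> U}| =o lam"
    using sequence_accumulates[OF assms(3,8,9)] by blast
  have "|{T\<in>\<Y>. T \<inter> U \<noteq> {}}| =o |\<Y>|" if U: "neighbourhood_of X x U" for U
  proof (rule ccontr)
    assume neg: "\<not> ?thesis"
    define A where "A = {\<alpha>\<in>Field kap. g \<alpha> \<inter> U \<noteq> {}}"
    have A: "A \<subseteq> Field kap" by (auto simp: A_def)
    have gA: "g ` A = {T\<in>\<Y>. T \<inter> U \<noteq> {}}"
      using g by (auto simp: A_def bij_betw_def)
    have "|{T\<in>\<Y>. T \<inter> U \<noteq> {}}| <o |\<Y>|"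
      using neg card_of_mono1[of "{T\<in>\<Y>. T \<inter> U \<noteq> {}}" \<Y>]
      by (auto simp: ordLeq_iff_ordLess_or_ordIso)
    then have "|A| <o kap"
      using iso[OF A] Y(2) unfolding gA
      by (meson ordIso_ordLess_trans ordIso_symmetric ordLess_ordIso_trans)
    then have small: "|{\<xi>\<in>Field lam. |A \<inter> S \<xi>| =o mu}| <o lam"
      using few A by blast
    obtain V where V: "openin X V" "x \<in> V" "V \<subseteq> U"
      using U by (auto simp: neighbourhood_of_def)
    have "|A \<inter> S \<xi>| =o mu" if \<xi>: "\<xi> \<in> Field lam" "y \<xi> \<in> V" for \<xi>
    proof -
      have "neighbourhood_of X (y \<xi>) U"
        using \<xi> V U by (auto simp: neighbourhood_of_def)
      then have "|{T\<in>g ` S \<xi>. T \<inter> U \<noteq> {}}| =o |g ` S \<xi>|"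
        using y[OF \<xi>(1)] by (auto simp: complete_acc_point_def)
      moreover have "{T\<in>g ` S \<xi>. T \<inter> U \<noteq> {}} = g ` (A \<inter> S \<xi>)"
        using S(1)[OF \<xi>(1)] by (auto simp: A_def)
      ultimately have "|g ` (A \<inter> S \<xi>)| =o |g ` S \<xi>|" by simp
      moreover have "|g ` (A \<inter> S \<xi>)| =o |A \<inter> S \<xi>|" "|g ` S \<xi>| =o |S \<xi>|"
        using iso A S(1)[OF \<xi>(1)] by blast+
      ultimately show ?thesis
        using S(2)[OF \<xi>(1)] by (meson ordIso_symmetric ordIso_transitive)
    qed
    then have "|{\<xi>\<in>Field lam. y \<xi> \<in> V}| \<le>o |{\<xi>\<in>Field lam. |A \<inter> S \<xi>| =o mu}|"
      by (intro card_of_mono1) blast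
    then have "|{\<xi>\<in>Field lam. y \<xi> \<in> V}| <o lam"
      using small by (rule ordLeq_ordLess_trans)
    moreover have "neighbourhood_of X x V"
      using V by (auto simp: neighbourhood_of_def dest: openin_subset)
    ultimately show False
      using acc not_ordLess_ordIso by blast
  qed
  then show "\<exists>x. complete_acc_point X \<Y> x"
    using x by (auto simp: complete_acc_point_def)
qed

end
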